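(* Fix $\mathbf{a}\in\mathbb{R}^{n_{\mathrm e}}_{\ge0}$, $\omega>0$ and $\mathbf{Q}\in\mathbb{R}^{n_{\mathrm{dof}}\times q}$, and set $\underline{\lambda}:=\omega^2$ and $\mathbf{S}:=\mathbf{K}(\mathbf{a})-\underline{\lambda}\mathbf{M}(\mathbf{a})$. Let $p_{\mathrm R}:=\frac{\omega}{2}\lambda_{\max}(\mathbf{Q}^{\mathsf T}\mathbf{S}^{\dagger}\mathbf{Q})$ be the worst-case peak input power, and assume that $p_{\mathrm R}>0$ and that $$\begin{pmatrix}\frac{2p_{\mathrm R}}{\omega}\mathbf{I}_q & -\mathbf{Q}^{\mathsf T}\\ -\mathbf{Q} & \mathbf{K}(\mathbf{a})-\omega^2\mathbf{M}(\mathbf{a})\end{pmatrix}\succeq\mathbf{0}.$$ Let $\mathbf{r}_q\in\mathbb{R}^q$ be a unit eigenvector of $\mathbf{Q}^{\mathsf T}\mathbf{S}^{\dagger}\mathbf{Q}$ associated with its largest eigenvalue, and let $\mathbf{f}_{\mathrm R}=\mathbf{Q}\mathbf{r}_q$ (the worst-case load) and $\mathbf{v}_{\mathrm R}:=\mathbf{S}^{\dagger}(\omega\mathbf{f}_{\mathrm R})$. Then $\mathbf{v}_{\mathrm R}\neq\mathbf{0}$ and $$\mathbf{K}(\mathbf{a})\mathbf{v}_{\mathrm R}=\underline{\lambda}\Big(\mathbf{M}(\mathbf{a})+\frac{1}{2\omega p_{\mathrm R}}\mathbf{Q}\mathbf{Q}^{\mathsf T}\Big)\mathbf{v}_{\mathrm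 R},$$ i.e., $\mathbf{v}_{\mathrm R}$ is an eigenvector of the generalized eigenvalue problem $\mathbf{K}(\mathbf{a})\mathbf{w}=\mu\big(\mathbf{M}(\mathbf{a})+\frac{1}{2\omega p_{\mathrm R}}\mathbf{Q}\mathbf{Q}^{\mathsf T}\big)\mathbf{w}$, and it is associated with the smallest positive eigenvalue $\mu=\underline{\lambda}$ of this problem.
   Context: For $\mathbf{a}\in\mathbb{R}^{n_{\mathrm e}}_{\ge 0}$ the stiffness and mass matrices are $\mathbf{K}(\mathbf{a})=\sum_{e=1}^{n_{\mathrm e}}\big[a_e\mathbf{K}^{(1)}_e+a_e^2\mathbf{K}^{(2)}_e+a_e^3\mathbf{K}^{(3)}_e\big]$ and $\mathbf{M}(\mathbf{a})=\mathbf{M}^{(0)}+\sum_{e=1}^{n_{\mathrm e}}a_e\mathbf{M}^{(1)}_e$, where all $\mathbf{K}^{(i)}_e$, $\mathbf{M}^{(0)}$, $\mathbf{M}^{(1)}_e$ are fixed real symmetric positive semidefinite $n_{\mathrm{dof}}\times n_{\mathrm{dof}}$ matrices. $\mathbf{A}\succeq\mathbf{0}$ means that the real symmetric matrix $\mathbf{A}$ is positive semidefinite, $(\cdot)^{\dagger}$ is the Moore-Penrose pseudoinverse, $\lambda_{\max}$ the largest eigenvalue, $\mathbf{I}_q$ the $q\times q$ identity. Eigenvalues of a generalized problem $\mathbf{K}\mathbf{w}=\mu\tilde{\mathbf{M}}\mathbf{w}$ with $\mathbf{K},\tilde{\mathbf{M}}\succeq\mathbf{0}$ are understood with eigenvectors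 $\mathbf{w}\notin\ker\tilde{\mathbf{M}}$. *)

theory Defs
  imports "HOL-Analysis.Analysis"
begin

definition psd :: "real^'n^'n \<Rightarrow> bool" where
  "psd A \<longleftrightarrow> transpose A = A \<and> (\<forall>x. 0 \<le> x \<bullet> (A *v x))"

definition eigenvector :: "real^'n^'n \<Rightarrow> real \<Rightarrow> real^'n \<Rightarrow> bool" where
  "eigenvector A \<mu> x \<longleftrightarrow> x \<noteq> 0 \<and> A *v x = \<mu> *\<^sub>R x"

text \<open>Meant for symmetric matrices, all of whose eigenvalues are real.\<close>

definition lambda_max :: "real^'n^'n \<Rightarrow> real" where
  "lambda_max A = Max {\<mu>. \<exists>x. eigenvector A \<mu> x}"

definition is_moore_penrose :: "real^'n^'m \<Rightarrow> real^'m^'n \<Rightarrow> bool" where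
  "is_moore_penrose A X \<longleftrightarrow>
     A ** X ** A = A \<and> X ** A ** X = X \<and>
     transpose (A ** X) = A ** X \<and> transpose (X ** A) = X ** A"

definition pinv :: "real^'n^'m \<Rightarrow> real^'m^'n" where
  "pinv A = (THE X. is_moore_penrose A X)"

definition block_mat ::
  "real^'p^'p \<Rightarrow> real^'n^'p \<Rightarrow> real^'p^'n \<Rightarrow> real^'n^'n \<Rightarrow> real^('p + 'n)^('p + 'n)" where
  "block_mat A B C D = (\<chi> i j.
     (case i of
        Inl k \<Rightarrow> (case j of Inl l \<Rightarrow> A $ k $ l | Inr l \<Rightarrow> B $ k $ l)
      | Inr k \<Rightarrow> (case j of Inl l \<Rightarrow> C $ k $ l | Inr l \<Rightarrow> D $ k $ l)))"

definition stiffness ::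
  "('e::finite \<Rightarrow> real^'n^'n) \<Rightarrow> ('e \<Rightarrow> real^'n^'n) \<Rightarrow> ('e \<Rightarrow> real^'n^'n) \<Rightarrow> real^'e \<Rightarrow> real^'n^'n" where
  "stiffness K1 K2 K3 a =
     (\<Sum>e\<in>UNIV. (a $ e) *\<^sub>R K1 e + (a $ e)^2 *\<^sub>R K2 e + (a $ e)^3 *\<^sub>R K3 e)"

definition mass ::
  "real^'n^'n \<Rightarrow> ('e::finite \<Rightarrow> real^'n^'n) \<Rightarrow> real^'e \<Rightarrow> real^'n^'n" where
  "mass M0 M1 a = M0 + (\<Sum>e\<in>UNIV. (a $ e) *\<^sub>R M1 e)"

text \<open>Vectors in the kernel of \<open>M\<close> are excluded; in particular \<open>w \<noteq> 0\<close>.\<close>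

definition gen_eigenvector :: "real^'n^'n \<Rightarrow> real^'n^'n \<Rightarrow> real \<Rightarrow> real^'n \<Rightarrow> bool" where
  "gen_eigenvector K M \<mu> w \<longleftrightarrow> M *v w \<noteq> 0 \<and> K *v w = \<mu> *\<^sub>R (M *v w)"

definition gen_eigenvalue :: "real^'n^'n \<Rightarrow> real^'n^'n \<Rightarrow> real \<Rightarrow> bool" where
  "gen_eigenvalue K M \<mu> \<longleftrightarrow> (\<exists>w. gen_eigenvector K M \<mu> w)"

lemma matrix_eq_on_inner:
  fixes A B :: "real^'n^'m"
  assumes "\<And>x y. y \<bullet> (A *v x) = y \<bullet> (B *v x)"
  shows "A = B"
  by (metis assms matrix_eq vector_eq_ldot)

lemma exists_left_projector:
  fixes A :: "real^'n^'m"
  shows "\<exists>G :: real^'m^'n. A ** G ** A = A \<and> transpose (G ** A) = G ** A"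
proof -
  define T where "T = range ((*v) (transpose A))"
  have sT: "subspace T"
    unfolding T_def by (intro linear_subspace_image subspace_UNIV) simp
  have ker: "A *v k = 0 \<longleftrightarrow> (\<forall>t\<in>T. orthogonal k t)" for k
  proof -
    have "k \<bullet> (transpose A *v y) = y \<bullet> (A *v k)" for y
      by (metis dot_lmul_matrix inner_commute transpose_matrix_vector)
    then show ?thesis
      unfolding T_def orthogonal_def by (auto, metis inner_eq_zero_iff)
  qed
  have inj: "inj_on ((*v) A) T"
  proof (rule inj_onI)
    fix x y assume "x \<in> T" "y \<in> T" "A *v x = A *v y"
    then have "x - y \<in> T" "A *v (x - y) = 0"
      using sT by (auto simp: subspace_diff matrix_vector_mult_diff_distrib)
    then have "orthogonal (x - y) (x - y)" using ker by blast
    then show "x = y" by (simp add: orthogonal_self)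
  qed
  obtain g where g: "range g \<subseteq> T" "linear g" "\<And>x. x \<in> T \<Longrightarrow> g (A *v x) = x"
    using linear_exists_left_inverse_on[of "(*v) A" T] sT inj by auto
  define G where "G = matrix g"
  have G: "G *v x = g x" for x using g(2) by (simp add: G_def matrix_works)
  have dec: "(G ** A) *v x \<in> T \<and> A *v (x - (G ** A) *v x) = 0" for x
  proof -
    obtain t k where tk: "t \<in> T" "\<And>w. w \<in> T \<Longrightarrow> orthogonal k w" "x = t + k"
      using orthogonal_subspace_decomp_exists[of T x] span_eq_iff[THEN iffD2, OF sT] by auto
    then have "A *v k = 0" using ker by blast
    then show ?thesis
      using tk g(3)[OF tk(1)]
      by (simp add: matrix_vector_mul_assoc[symmetric] G matrix_vector_right_distrib)
  qed
  have "A ** G ** A = A"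
    using dec
    by (simp add: matrix_eq matrix_vector_mul_assoc[symmetric] matrix_vector_mult_diff_distrib)
  moreover have "transpose (G ** A) = G ** A"
  proof (rule matrix_eq_on_inner)
    fix x y
    let ?P = "G ** A"
    have 1: "(u - ?P *v u) \<bullet> (?P *v v) = 0" for u v
      using dec[of u] dec[of v] ker by (auto simp: orthogonal_def)
    have "y \<bullet> (?P *v x) = (?P *v y) \<bullet> (?P *v x)" using 1[of y x] by (simp add: inner_diff_left)
    moreover have "x \<bullet> (?P *v y) = (?P *v x) \<bullet> (?P *v y)" using 1[of x y] by (simp add: inner_diff_left)
    moreover have "y \<bullet> (transpose ?P *v x) = x \<bullet> (?P *v y)"
      by (metis dot_lmul_matrix inner_commute transpose_matrix_vector)
    ultimately show "y \<bullet> (transpose ?P *v x) = y \<bullet> (?P *v x)" by (simp add: inner_commute)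
  qed
  ultimately show ?thesis by blast
qed

lemma moore_penrose_exists:
  fixes A :: "real^'n^'m"
  shows "\<exists>X. is_moore_penrose A X"
proof -
  obtain G :: "real^'m^'n" where G: "A ** G ** A = A" "transpose (G ** A) = G ** A"
    using exists_left_projector by blast
  obtain H0 :: "real^'n^'m" where H0: "transpose A ** H0 ** transpose A = transpose A"
      "transpose (H0 ** transpose A) = H0 ** transpose A"
    using exists_left_projector by blast
  define H where "H = transpose H0"
  have H: "A ** H ** A = A" "transpose (A ** H) = A ** H"
    unfolding H_def using H0 by (metis matrix_mul_assoc matrix_transpose_mul transpose_transpose)+
  define X where "X = G ** A ** H"
  have "A ** X = A ** H" "X ** A = G ** A"
    using G(1) H(1) by (simp_all add: X_def matrix_mul_assoc) (metis matrix_mul_assoc)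
  then have "is_moore_penrose A X"
    unfolding is_moore_penrose_def using G H
    by (metis X_def matrix_mul_assoc)
  then show ?thesis by blast
qed

lemma moore_penrose_unique:
  assumes "is_moore_penrose A X" "is_moore_penrose A Y"
  shows "X = Y"
proof -
  note X = assms(1)[unfolded is_moore_penrose_def]
  note Y = assms(2)[unfolded is_moore_penrose_def]
  have AX: "A ** X = A ** Y"
  proof -
    have "A ** X = transpose ((A ** Y) ** (A ** X))"
      unfolding matrix_mul_assoc using X Y by simp
    also have "\<dots> = (A ** X) ** (A ** Y)"
      by (subst matrix_transpose_mul) (use X Y in simp)
    also have "\<dots> = A ** Y"
      unfolding matrix_mul_assoc using X by simp
    finally show ?thesis .
  qed
  have XA: "X ** A = Y ** A"
  proof -
    have "(X ** A) ** (Y ** A) = X ** (A ** Y ** A)" by (simp only: matrix_mul_assoc)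
    then have "X ** A = transpose ((X ** A) ** (Y ** A))"
      using X Y by simp
    also have "\<dots> = (Y ** A) ** (X ** A)"
      by (subst matrix_transpose_mul) (use X Y in simp)
    also have "\<dots> = Y ** (A ** X ** A)"
      by (simp only: matrix_mul_assoc)
    finally show ?thesis using X by simp
  qed
  have "X = X ** A ** X" using X by simp
  also have "\<dots> = Y ** (A ** X)" by (simp only: XA matrix_mul_assoc)
  also have "\<dots> = Y ** A ** Y" by (simp only: AX matrix_mul_assoc)
  finally show ?thesis using Y by simp
qed

lemma pinv_is_moore_penrose: "is_moore_penrose A (pinv A)"
  unfolding pinv_def by (rule theI') (use moore_penrose_exists moore_penrose_unique in blast)

lemma transpose_inner:
  fixes A :: "real^'n^'m"
  shows "y \<bullet> (A *v x) = (transpose A *v y) \<bullet> x"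
  by (simp add: dot_lmul_matrix transpose_matrix_vector)

lemma finite_eigenvalues_symmetric:
  fixes A :: "real^'n^'n"
  assumes A: "transpose A = A"
  shows "finite {\<mu>. \<exists>x. eigenvector A \<mu> x}"
proof -
  let ?E = "{\<mu>. \<exists>x. eigenvector A \<mu> x}"
  define f where "f \<mu> = (SOME x. eigenvector A \<mu> x)" for \<mu>
  have f: "eigenvector A \<mu> (f \<mu>)" if "\<mu> \<in> ?E" for \<mu>
    using that unfolding f_def by (auto intro: someI)
  have orth: "f \<mu> \<bullet> f \<nu> = 0" if "\<mu> \<in> ?E" "\<nu> \<in> ?E" "\<mu> \<noteq> \<nu>" for \<mu> \<nu>
  proof -
    have "f \<mu> \<bullet> (A *v f \<nu>) = (A *v f \<mu>) \<bullet> f \<nu>" using transpose_inner[of "f \<mu>" A] A by simp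
    then have "\<nu> * (f \<mu> \<bullet> f \<nu>) = \<mu> * (f \<mu> \<bullet> f \<nu>)"
      using f[OF that(1)] f[OF that(2)] by (simp add: eigenvector_def)
    then show ?thesis using that(3) by simp
  qed
  have nz: "f \<mu> \<noteq> 0" if "\<mu> \<in> ?E" for \<mu> using f[OF that] by (simp add: eigenvector_def)
  have "inj_on f ?E" 
  proof (rule inj_onI, rule ccontr)
    fix \<mu> \<nu> assume "\<mu> \<in> ?E" "\<nu> \<in> ?E" "f \<mu> = f \<nu>" "\<mu> \<noteq> \<nu>"
    then show False using orth[of \<mu> \<nu>] nz[of \<nu>] by simp
  qed
  moreover have "independent (f ` ?E)"
  proof (rule pairwise_orthogonal_independent)
    show "pairwise orthogonal (f ` ?E)"
      unfolding pairwise_image pairwise_def orthogonal_def using orth by blast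
    show "0 \<notin> f ` ?E" using nz by force
  qed
  then have "finite (f ` ?E)" using independent_bound by blast
  ultimately show ?thesis using finite_imageD by blast
qed

lemma eigenvalue_exists_symmetric:
  fixes A :: "real^'n^'n"
  assumes A: "transpose A = A"
  shows "{\<mu>. \<exists>x. eigenvector A \<mu> x} \<noteq> {}"
proof -
  have cont: "continuous_on (sphere 0 1) (\<lambda>x. x \<bullet> (A *v x))"
    by (intro continuous_intros linear_continuous_on) (simp add: linear_linear)
  have "\<exists>u\<in>sphere (0::real^'n) 1. \<forall>x\<in>sphere 0 1. x \<bullet> (A *v x) \<le> u \<bullet> (A *v u)"
    by (rule continuous_attains_sup[OF _ _ cont]) simp_all
  then obtain u where u: "norm u = 1" "\<And>x. norm x = 1 \<Longrightarrow> x \<bullet> (A *v x) \<le> u \<bullet> (A *v u)"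
    by auto
  define m where "m = u \<bullet> (A *v u)"
  define q where "q x = m * (x \<bullet> x) - x \<bullet> (A *v x)" for x
  have qpos: "0 \<le> q x" for x
  proof (cases "x = 0")
    case False
    define y where "y = (1 / norm x) *\<^sub>R x"
    have x: "x = norm x *\<^sub>R y" and y: "norm y = 1" using False by (simp_all add: y_def)
    have "q (c *\<^sub>R y) = c ^ 2 * (m - y \<bullet> (A *v y))" for c
      using y by (simp add: q_def matrix_vector_mult_scaleR power2_eq_square
          right_diff_distrib norm_eq_1)
    then have "q x = norm x ^ 2 * (m - y \<bullet> (A *v y))" using x by metis
    then show ?thesis using u(2)[OF y] by (simp add: m_def)
  qed (simp add: q_def)
  define y where "y = m *\<^sub>R u - A *v u"
  have uu: "u \<bullet> u = 1" using u(1) by (simp add: norm_eq_1)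
  have yu: "u \<bullet> (A *v y) = y \<bullet> (A *v u)" using transpose_inner[of u A y] A by (simp add: inner_commute)
  have exp: "q (u + t *\<^sub>R y) = 2 * t * (y \<bullet> y) + t^2 * q y" for t
  proof -
    have "q (u + t *\<^sub>R y) = m - m + 2 * t * (m * (y \<bullet> u) - y \<bullet> (A *v u)) + t^2 * q y"
      using uu yu by (simp add: q_def m_def matrix_vector_right_distrib matrix_vector_mult_scaleR
          inner_add_left inner_add_right inner_commute[of u y] algebra_simps power2_eq_square)
    moreover have "m * (y \<bullet> u) - y \<bullet> (A *v u) = y \<bullet> y"
      by (subst (4) y_def) (simp add: inner_diff_right)
    ultimately show ?thesis by simp
  qed
  have "y \<bullet> y = 0"
  proof (rule ccontr)
    assume "y \<bullet> y \<noteq> 0"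
    then have c: "0 < y \<bullet> y" by simp
    define d where "d = q y"
    define t where "t = - (y \<bullet> y) / (d + 1)"
    have d: "0 \<le> d" using qpos d_def by simp
    have "t < 0" using c d by (simp add: t_def divide_neg_pos)
    have "- t * d \<le> y \<bullet> y" using c d by (simp add: t_def field_simps)
    then have "0 < 2 * (y \<bullet> y) + t * d" using c by linarith
    then have "t * (2 * (y \<bullet> y) + t * d) < 0" using \<open>t < 0\<close> by (simp add: mult_neg_pos)
    then show False using qpos[of "u + t *\<^sub>R y"] exp[of t]
      by (simp add: d_def power2_eq_square algebra_simps)
  qed
  then have "eigenvector A m u" using u(1) by (auto simp: eigenvector_def y_def)
  then show ?thesis by blast
qed

text \<open>For symmetric matrices, the maximum in the definition of \<open>lambda_max\<close> is attained.\<close>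

lemma lambda_max_symmetric:
  fixes A :: "real^'n^'n"
  assumes "transpose A = A"
  shows "\<exists>x. eigenvector A (lambda_max A) x"
    and "eigenvector A \<mu> x \<Longrightarrow> \<mu> \<le> lambda_max A"
proof -
  note fin = finite_eigenvalues_symmetric[OF assms]
  show "\<exists>x. eigenvector A (lambda_max A) x"
    using Max_in[OF fin eigenvalue_exists_symmetric[OF assms]] by (simp add: lambda_max_def)
  show "\<mu> \<le> lambda_max A" if "eigenvector A \<mu> x"
    unfolding lambda_max_def using fin that by (intro Max_ge) auto
qed

end

theory Submission
  imports Defs
begin

text \<open>
  Write \<open>t = 2 * pR / \<omega>\<close>, the largest eigenvalue of \<open>Q\<^sup>T S\<^sup>\<dagger> Q\<close>.  Scaled by \<open>\<omega>\<^sup>2\<close>, the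
  factor \<open>1 / (2 * \<omega> * pR)\<close> in front of \<open>Q Q\<^sup>T\<close> becomes \<open>1 / t\<close>, so with
  \<open>Mt = M + 1 / (2 * \<omega> * pR) Q Q\<^sup>T\<close> the matrix \<open>N = K - lam Mt\<close> is \<open>S - (1 / t) Q Q\<^sup>T\<close>: the Schur
  complement of the block \<open>t I\<close> in the given matrix inequality.  Hence \<open>N\<close> is positive semidefinite
  (\<open>psd_schur_complement\<close>), and the claims follow from three observations.

  First, positivity of \<open>N\<close> forces \<open>ker S \<subseteq> ker Q\<^sup>T\<close>.  The columns of \<open>Q\<close> therefore lie in the range
  of \<open>S\<close>, so that \<open>S S\<^sup>\<dagger> Q = Q\<close> (\<open>pinv_right_inverse_on_range\<close>).

  Secondly, this gives \<open>S vR = \<omega> Q rq\<close>, while the eigenvector equation for \<open>rq\<close> reads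
  \<open>Q\<^sup>T vR = \<omega> t rq\<close>.  Together they say \<open>S vR = (1 / t) Q Q\<^sup>T vR\<close>, that is, \<open>N vR = 0\<close>; and
  \<open>Q\<^sup>T vR \<noteq> 0\<close> shows that neither \<open>vR\<close> nor \<open>Mt vR\<close> vanishes.

  Thirdly, \<open>K - lam Mt\<close> being positive semidefinite means that every Rayleigh quotient of the pencil
  \<open>(K, Mt)\<close> is at least \<open>lam\<close>, and so is every eigenvalue (\<open>gen_eigenvalue_lower_bound\<close>).
\<close>

text \<open>
  With this rule active, the simplifier would replace \<open>transpose Q *v y\<close> by \<open>y v* Q\<close>,
  and facts about the product with the transpose would no longer apply.
\<close>

declare transpose_matrix_vector [simp del]

lemma psd_add: "psd A \<Longrightarrow> psd B \<Longrightarrow> psd (A + B)"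
  by (simp add: psd_def transpose_def vec_eq_iff matrix_vector_mult_add_rdistrib inner_add_right)

lemma psd_scaleR: "0 \<le> c \<Longrightarrow> psd A \<Longrightarrow> psd (c *\<^sub>R A)"
  by (simp add: psd_def transpose_scalar scaleR_matrix_vector_assoc[symmetric])

lemma psd_zero: "psd 0"
  by (simp add: psd_def transpose_def vec_eq_iff)

lemma psd_sum: "(\<And>i. i \<in> I \<Longrightarrow> psd (A i)) \<Longrightarrow> psd (\<Sum>i\<in>I. A i)"
  by (induction I rule: infinite_finite_induct) (simp_all add: psd_zero psd_add)

lemma inner_gram:
  fixes Q :: "real^'q^'n"
  shows "x \<bullet> ((Q ** transpose Q) *v y) = (transpose Q *v x) \<bullet> (transpose Q *v y)"
  by (simp only: matrix_vector_mul_assoc[symmetric] transpose_inner[of x Q])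

lemma psd_gram: "psd (Q ** transpose Q)"
  by (simp add: psd_def matrix_transpose_mul inner_gram)

lemma psd_mass:
  assumes "psd M0" "\<And>e. psd (M1 e)" "\<And>e. 0 \<le> a $ e"
  shows "psd (mass M0 M1 a)"
  unfolding mass_def using assms by (intro psd_add psd_sum psd_scaleR)

text \<open>
  An isotropic vector minimises the quadratic form, so the gradient \<open>2 A x\<close> vanishes there.  The
  proof makes this explicit by a short step from \<open>x\<close> in the direction \<open>- A x\<close>.
\<close>

lemma psd_isotropic_imp_kernel:
  assumes A: "psd A" and x: "x \<bullet> (A *v x) = 0"
  shows "A *v x = 0"
proof (rule ccontr)
  assume nz: "A *v x \<noteq> 0"
  define y where "y = A *v x"
  define d where "d = y \<bullet> (A *v y)"
  \<comment> \<open>Small enough for the linear decrease \<open>2 s (y \<bullet> y)\<close> to outweigh the term \<open>s\<^sup>2 d\<close>; the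
    summand \<open>1\<close> covers \<open>d = 0\<close>.\<close>
  define s where "s = (y \<bullet> y) / (d + 1)"
  have yy: "0 < y \<bullet> y" using nz by (simp add: y_def)
  have d: "0 \<le> d" using A by (simp add: psd_def d_def)
  have s: "0 < s" "s * d \<le> y \<bullet> y"
    using yy d by (simp_all add: s_def field_simps)
  have xy: "x \<bullet> (A *v y) = y \<bullet> y"
    using A transpose_inner[of x A y] by (simp add: psd_def y_def)
  have "(x - s *\<^sub>R y) \<bullet> (A *v (x - s *\<^sub>R y)) = s * (s * d - 2 * (y \<bullet> y))"
    using x xy by (simp add: matrix_vector_mult_diff_distrib matrix_vector_mult_scaleR
        inner_diff_left inner_diff_right d_def y_def[symmetric] algebra_simps)
  moreover have "s * (s * d - 2 * (y \<bullet> y)) < 0"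
    using s yy by (intro mult_pos_neg) linarith+
  ultimately show False using A unfolding psd_def by (metis not_less)
qed

lemma sum_UNIV_Plus:
  fixes f :: "'a::finite + 'b::finite \<Rightarrow> 'c::comm_monoid_add"
  shows "(\<Sum>i\<in>UNIV. f i) = (\<Sum>k\<in>UNIV. f (Inl k)) + (\<Sum>k\<in>UNIV. f (Inr k))"
  by (simp add: UNIV_Plus_UNIV[symmetric] sum.Plus del: UNIV_Plus_UNIV)

lemma block_mat_quadratic_form:
  fixes A :: "real^'p^'p" and B :: "real^'n^'p" and C :: "real^'p^'n" and D :: "real^'n^'n"
  defines "w x y \<equiv> \<chi> i. case i of Inl k \<Rightarrow> (x::real^'p) $ k | Inr k \<Rightarrow> (y::real^'n) $ k"
  shows "w x y \<bullet> (block_mat A B C D *v w x y)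
    = x \<bullet> (A *v x) + x \<bullet> (B *v y) + y \<bullet> (C *v x) + y \<bullet> (D *v y)"
  by (simp add: w_def inner_vec_def matrix_vector_mult_def block_mat_def sum_UNIV_Plus
      sum.distrib distrib_left)

lemma block_mat_symmetric_lower:
  assumes "transpose (block_mat A B C D) = block_mat A B C D"
  shows "transpose D = D"
proof -
  have "transpose (block_mat A B C D) $ Inr i $ Inr j = block_mat A B C D $ Inr i $ Inr j" for i j
    using assms by simp
  then show ?thesis by (simp add: transpose_def block_mat_def vec_eq_iff)
qed

lemma minus_matrix_vector_mult: "(- A :: real^'n^'m) *v x = - (A *v x)"
  by (simp add: matrix_vector_mult_def vec_eq_iff sum_negf)

text \<open>
  For fixed \<open>y\<close>, the form \<open>t (x \<bullet> x) - 2 x \<bullet> Q\<^sup>T y + y \<bullet> S y\<close> of the block matrix is minimal at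
  \<open>x = (1 / t) Q\<^sup>T y\<close>, and its minimum is the form of the Schur complement at \<open>y\<close>.
\<close>

lemma psd_schur_complement:
  fixes Q :: "real^'q^'n"
  assumes t: "0 < t"
    and blk: "psd (block_mat (t *\<^sub>R mat 1) (- transpose Q) (- Q) S)"
  shows "psd (S - (1 / t) *\<^sub>R (Q ** transpose Q))"
  unfolding psd_def
proof (intro conjI allI)
  have "transpose S = S"
    using blk block_mat_symmetric_lower unfolding psd_def by blast
  then show "transpose (S - (1 / t) *\<^sub>R (Q ** transpose Q)) = S - (1 / t) *\<^sub>R (Q ** transpose Q)"
    using psd_gram[of Q] by (simp add: psd_def transpose_def vec_eq_iff)
next
  fix y
  define z where "z = transpose Q *v y"
  define x where "x = (1 / t) *\<^sub>R z"
  have "0 \<le> x \<bullet> ((t *\<^sub>R mat 1) *v x) + x \<bullet> (- transpose Q *v y) + y \<bullet> (- Q *v x) + y \<bullet> (S *v y)"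
    using blk by (subst block_mat_quadratic_form[symmetric]) (simp add: psd_def)
  also have "\<dots> = t * (x \<bullet> x) - 2 * (x \<bullet> z) + y \<bullet> (S *v y)"
    using transpose_inner[of y Q x]
    by (simp add: z_def[symmetric] scaleR_matrix_vector_assoc[symmetric] minus_matrix_vector_mult
        inner_commute[of z x])
  also have "\<dots> = y \<bullet> (S *v y) - (1 / t) * (z \<bullet> z)"
    using t by (simp add: x_def)
  also have "\<dots> = y \<bullet> ((S - (1 / t) *\<^sub>R (Q ** transpose Q)) *v y)"
    by (simp add: matrix_vector_mult_diff_rdistrib inner_diff_right
        scaleR_matrix_vector_assoc[symmetric] inner_gram z_def)
  finally show "0 \<le> y \<bullet> ((S - (1 / t) *\<^sub>R (Q ** transpose Q)) *v y)" .
qed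

text \<open>
  The projector \<open>P = A A\<^sup>\<dagger>\<close> satisfies \<open>A P = A\<close> when \<open>A\<close> is symmetric, so \<open>I - P\<close> maps into
  \<open>ker A\<close>, where \<open>Q\<^sup>T\<close> vanishes.  Transposing \<open>Q\<^sup>T (I - P) = 0\<close> gives the claim.
\<close>

lemma pinv_right_inverse_on_range:
  fixes A :: "real^'n^'n" and Q :: "real^'q^'n"
  assumes A: "transpose A = A"
    and ker: "\<And>y. A *v y = 0 \<Longrightarrow> transpose Q *v y = 0"
  shows "A ** pinv A ** Q = Q"
proof -
  define P where "P = A ** pinv A"
  have mp: "P ** A = A" "transpose P = P"
    using pinv_is_moore_penrose[of A] by (auto simp: is_moore_penrose_def P_def)
  have AP: "A ** P = A"
    by (metis A matrix_transpose_mul mp)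
  have "transpose Q *v (y - P *v y) = 0" for y
    by (rule ker) (simp add: matrix_vector_mult_diff_distrib matrix_vector_mul_assoc AP)
  then have "transpose Q ** P = transpose Q"
    by (simp add: matrix_eq matrix_vector_mult_diff_distrib matrix_vector_mul_assoc)
  then show ?thesis
    unfolding P_def[symmetric] by (metis matrix_transpose_mul mp(2) transpose_transpose)
qed

text \<open>
  Pairing \<open>K w = \<mu> M w\<close> with \<open>w\<close> turns positivity of \<open>K - \<nu> M\<close> into \<open>0 \<le> (\<mu> - \<nu>) (w \<bullet> M w)\<close>; the
  condition \<open>w \<notin> ker M\<close> makes the second factor positive.
\<close>

lemma gen_eigenvalue_lower_bound:
  assumes M: "psd M" and KM: "psd (K - \<nu> *\<^sub>R M)" and \<mu>: "gen_eigenvalue K M \<mu>"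
  shows "\<nu> \<le> \<mu>"
proof -
  obtain w where w: "M *v w \<noteq> 0" "K *v w = \<mu> *\<^sub>R (M *v w)"
    using \<mu> by (auto simp: gen_eigenvalue_def gen_eigenvector_def)
  have "0 \<le> w \<bullet> (M *v w)" "w \<bullet> (M *v w) \<noteq> 0"
    using M w(1) psd_isotropic_imp_kernel by (auto simp: psd_def)
  then have pos: "0 < w \<bullet> (M *v w)" by linarith
  have "0 \<le> w \<bullet> ((K - \<nu> *\<^sub>R M) *v w)"
    using KM by (simp add: psd_def)
  also have "\<dots> = (\<mu> - \<nu>) * (w \<bullet> (M *v w))"
    using w(2) by (simp add: matrix_vector_mult_diff_rdistrib scaleR_matrix_vector_assoc[symmetric]
        inner_diff_right algebra_simps)
  finally show ?thesis
    using pos by (simp add: zero_le_mult_iff)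
qed

theorem lemma6:
  fixes K1 K2 K3 M1 :: "'e::finite \<Rightarrow> real^'n^'n"
    and M0 S :: "real^'n^'n"
    and a :: "real^'e"
    and Q :: "real^'q^'n"
    and \<omega> lam pR :: real
    and rq :: "real^'q"
    and fR vR :: "real^'n"
  assumes K1: "\<And>e. psd (K1 e)" and K2: "\<And>e. psd (K2 e)" and K3: "\<And>e. psd (K3 e)"
    and M0: "psd M0" and M1: "\<And>e. psd (M1 e)"
    and a: "\<And>e. 0 \<le> a $ e"
    and \<omega>: "0 < \<omega>"
    and lam: "lam = \<omega>^2"
    and S: "S = stiffness K1 K2 K3 a - lam *\<^sub>R mass M0 M1 a"
    and pR: "pR = \<omega> / 2 * lambda_max (transpose Q ** pinv S ** Q)"
    and pR_pos: "0 < pR"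
    and lmi: "psd (block_mat ((2 * pR / \<omega>) *\<^sub>R mat 1) (- transpose Q)
                             (- Q) (stiffness K1 K2 K3 a - \<omega>^2 *\<^sub>R mass M0 M1 a))"
    and rq_unit: "norm rq = 1"
    and rq_eig: "eigenvector (transpose Q ** pinv S ** Q)
                   (lambda_max (transpose Q ** pinv S ** Q)) rq"
    and fR: "fR = Q *v rq"
    and vR: "vR = pinv S *v (\<omega> *\<^sub>R fR)"
  shows "vR \<noteq> 0 \<and>
    (let K = stiffness K1 K2 K3 a;
         Mt = mass M0 M1 a + (1 / (2 * \<omega> * pR)) *\<^sub>R (Q ** transpose Q)
     in K *v vR = lam *\<^sub>R (Mt *v vR) \<and>
        gen_eigenvector K Mt lam vR \<and>
        0 < lam \<and>
        (\<forall>\<mu>. 0 < \<mu> \<and> gen_eigenvalue K Mt \<mu> \<longrightarrow> lam \<le> \<mu>))"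
proof -
  define K where "K = stiffness K1 K2 K3 a"
  define M where "M = mass M0 M1 a"
  define t where "t = 2 * pR / \<omega>"
  define Mt where "Mt = M + (1 / (2 * \<omega> * pR)) *\<^sub>R (Q ** transpose Q)"
  define N where "N = S - (1 / t) *\<^sub>R (Q ** transpose Q)"
  have t_pos: "0 < t" using pR_pos \<omega> by (simp add: t_def)
  have t_eig: "lambda_max (transpose Q ** pinv S ** Q) = t"
    unfolding t_def pR using \<omega> by simp
  have blk: "psd (block_mat (t *\<^sub>R mat 1) (- transpose Q) (- Q) S)"
    using lmi by (simp add: t_def S lam)
  have N_psd: "psd N"
    unfolding N_def using psd_schur_complement[OF t_pos blk] .
  have N_eq: "N = K - lam *\<^sub>R Mt"
  proof -
    have "lam * (1 / (2 * \<omega> * pR)) = 1 / t"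
      using \<omega> pR_pos by (simp add: t_def lam power2_eq_square)
    then show ?thesis
      by (simp add: N_def Mt_def S K_def M_def scaleR_add_right)
  qed
  have Mt_psd: "psd Mt"
    unfolding Mt_def M_def
    using M0 M1 a \<omega> pR_pos by (intro psd_add psd_mass psd_scaleR psd_gram) simp_all

  have S_sym: "transpose S = S"
    using blk block_mat_symmetric_lower unfolding psd_def by blast
  have ker: "transpose Q *v y = 0" if "S *v y = 0" for y
  proof -
    have "0 \<le> y \<bullet> (N *v y)" using N_psd by (simp add: psd_def)
    also have "\<dots> = - (1 / t) * ((transpose Q *v y) \<bullet> (transpose Q *v y))"
      using that by (simp add: N_def matrix_vector_mult_diff_rdistrib inner_diff_right
          scaleR_matrix_vector_assoc[symmetric] inner_gram)
    finally have "(transpose Q *v y) \<bullet> (transpose Q *v y) \<le> 0"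
      using t_pos by (simp add: divide_le_0_iff)
    then show ?thesis by (metis inner_eq_zero_iff inner_ge_zero order_antisym)
  qed
  have S_vR: "S *v vR = \<omega> *\<^sub>R (Q *v rq)"
    using pinv_right_inverse_on_range[OF S_sym ker]
    by (simp add: vR fR matrix_vector_mult_scaleR matrix_vector_mul_assoc matrix_mul_assoc)
  have Q_vR: "transpose Q *v vR = (\<omega> * t) *\<^sub>R rq"
    using rq_eig
    by (simp add: t_eig eigenvector_def vR fR matrix_vector_mult_scaleR matrix_vector_mul_assoc
        matrix_mul_assoc)
  have "N *v vR = 0"
    using t_pos
    by (simp add: N_def matrix_vector_mult_diff_rdistrib scaleR_matrix_vector_assoc[symmetric] S_vR
        matrix_vector_mul_assoc[symmetric] Q_vR matrix_vector_mult_scaleR)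
  then have eig: "K *v vR = lam *\<^sub>R (Mt *v vR)"
    by (simp add: N_eq matrix_vector_mult_diff_rdistrib scaleR_matrix_vector_assoc[symmetric])

  have Q_vR_nz: "transpose Q *v vR \<noteq> 0"
    using Q_vR \<omega> t_pos rq_unit by auto
  have "0 < vR \<bullet> (Mt *v vR)"
  proof -
    have "0 \<le> vR \<bullet> (M *v vR)"
      using psd_mass[OF M0 M1 a] by (simp add: psd_def M_def)
    moreover have "0 < (1 / (2 * \<omega> * pR)) * ((transpose Q *v vR) \<bullet> (transpose Q *v vR))"
      using Q_vR_nz \<omega> pR_pos by (intro mult_pos_pos) simp_all
    ultimately show ?thesis
      by (simp add: Mt_def matrix_vector_mult_add_rdistrib inner_add_right
          scaleR_matrix_vector_assoc[symmetric] inner_gram)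
  qed
  then have Mt_vR_nz: "Mt *v vR \<noteq> 0" by auto

  have min: "lam \<le> \<mu>" if "gen_eigenvalue K Mt \<mu>" for \<mu>
    using gen_eigenvalue_lower_bound[OF Mt_psd _ that] N_psd by (simp add: N_eq)
  have vR_nz: "vR \<noteq> 0" using Q_vR_nz by auto
  have lam_pos: "0 < lam" using \<omega> by (simp add: lam)
  show ?thesis
    unfolding Let_def K_def[symmetric] M_def[symmetric] Mt_def[symmetric] gen_eigenvector_def
    using vR_nz eig Mt_vR_nz lam_pos min by blast
qed

end
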